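(* Let $k \geq 1$ and $n \geq 0$ be integers, and let $f_k(n)$ denote the number of abelian squares of length $2n$ over an alphabet with $k$ letters. Then $$ f_k(n) = \sum_{n_1 + \cdots + n_k = n} \left( \frac{n!}{n_1! \, n_2! \cdots n_k!} \right)^2, $$ where the sum is over all $k$-tuples $(n_1, \ldots, n_k)$ of non-negative integers with sum $n$.
   Context: An abelian square of length $2n$ is a string of the form $x x'$ where $|x| = |x'| = n$ and $x'$ is a permutation (rearrangement) of the symbols of $x$; equivalently, every letter of the alphabet occurs the same number of times in $x$ as in $x'$. The quantity $f_k(n)$ is the number of such strings over the alphabet $\{1, 2, \ldots, k\}$. By convention $f_k(0) = 1$ (the empty string is counted when $n = 0$). *)

theory Defs
  imports Complex_Main "HOL-Library.Multiset"
begin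

definition abelian_square :: "'a list \<Rightarrow> bool" where
  "abelian_square w \<longleftrightarrow> (\<exists>x x'. w = x @ x' \<and> length x = length x' \<and> mset x' = mset x)"

definition abelian_squares :: "nat \<Rightarrow> nat \<Rightarrow> nat list set" where
  "abelian_squares k n = {w. set w \<subseteq> {1..k} \<and> length w = 2 * n \<and> abelian_square w}"

definition num_abelian_squares :: "nat \<Rightarrow> nat \<Rightarrow> nat" where
  "num_abelian_squares k n = card (abelian_squares k n)"

(* k-tuples of non-negative integers are lists of length k *)
definition tuples_with_sum :: "nat \<Rightarrow> nat \<Rightarrow> nat list set" where
  "tuples_with_sum k n = {ns. length ns = k \<and> sum_list ns = n}"

end

(* Fibre the abelian squares over the common letter multiset A of their two halves: the fibre is
   the set of pairs of arrangements of A, and the arrangements of A are counted by a multinomial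
   coefficient. *)
theory Submission
  imports Defs "HOL-Combinatorics.Multiset_Permutations"
begin

text \<open>The component \<open>A\<close> is determined by \<open>x\<close>, but carrying it along
  makes the domain a disjoint union indexed by multisets, so its cardinality becomes a sum over
  \<open>A\<close>.\<close>

lemma abelian_squares_eq_image:
  "abelian_squares k n =
    (\<lambda>(A, x, y). x @ y) `
      (SIGMA A : multisets_of_size {1..k} n.
        permutations_of_multiset A \<times> permutations_of_multiset A)"
  (is "?L = ?R")
proof
  show "?L \<subseteq> ?R"
  proof
    fix w assume "w \<in> ?L"
    then obtain x y where w: "w = x @ y" "mset y = mset x"
        and xy: "set w \<subseteq> {1..k}" "length w = 2 * n" "length x = length y"
      by (auto simp: abelian_squares_def abelian_square_def)
    then have "(mset x, x, y) \<in> (SIGMA A : multisets_of_size {1..k} n.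
        permutations_of_multiset A \<times> permutations_of_multiset A)"
      by (auto simp: multisets_of_size_def permutations_of_multiset_def)
    then show "w \<in> ?R"
      unfolding w(1) by (rule rev_image_eqI) simp
  qed
  show "?R \<subseteq> ?L"
  proof
    fix w assume "w \<in> ?R"
    then obtain A x y where w: "w = x @ y" "mset x = A" "mset y = A"
        and A: "set_mset A \<subseteq> {1..k}" "size A = n"
      by (auto simp: multisets_of_size_def permutations_of_multiset_def)
    have len: "length x = n" "length y = n"
      using A(2) by (simp_all flip: size_mset add: w)
    have set: "set x \<subseteq> {1..k}" "set y \<subseteq> {1..k}"
      using A(1) by (simp_all flip: set_mset_mset add: w del: atLeastAtMost_iff)
    show "w \<in> ?L"
      unfolding abelian_squares_def abelian_square_def
    proof (intro CollectI conjI exI)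
      show "set w \<subseteq> {1..k}" "length w = 2 * n" "w = x @ y" "length x = length y"
          "mset y = mset x"
        using w len set by simp_all
    qed
  qed
qed

lemma num_abelian_squares_eq_sum_multisets:
  "num_abelian_squares k n =
    (\<Sum>A \<in> multisets_of_size {1..k} n. (card (permutations_of_multiset A))\<^sup>2)"
proof -
  let ?S = "SIGMA A : multisets_of_size {1..k} n.
    permutations_of_multiset A \<times> permutations_of_multiset A"
  have "inj_on (\<lambda>(A, x, y). x @ y) ?S"
  proof (rule inj_onI)
    fix p q
    assume "p \<in> ?S" "q \<in> ?S" and app: "(\<lambda>(A, x, y). x @ y) p = (\<lambda>(A, x, y). x @ y) q"
    then obtain A x y B u v where pq: "p = (A, x, y)" "q = (B, u, v)"
      and "A \<in> multisets_of_size {1..k} n" "B \<in> multisets_of_size {1..k} n"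
      and x: "x \<in> permutations_of_multiset A" and u: "u \<in> permutations_of_multiset B"
      by blast
    have eq: "x @ y = u @ v"
      using app pq by simp
    \<comment> \<open>Both \<open>x\<close> and \<open>u\<close> have length \<open>n\<close>, so
      the common word is cut at the same place in both factorisations; the multiset is then
      recovered as \<open>mset x\<close>.\<close>
    have "size A = n" "size B = n"
      by (rule multisets_of_size_size, fact)+
    with x u have "size (mset x) = size (mset u)"
      by (simp only: permutations_of_multisetD)
    with eq have "x = u" "y = v"
      by simp_all
    moreover have "A = B"
      using permutations_of_multisetD[OF x] permutations_of_multisetD[OF u] \<open>x = u\<close> by simp
    ultimately show "p = q"
      using pq by simp
  qed
  then have "num_abelian_squares k n = card ?S"
    by (simp add: num_abelian_squares_def abelian_squares_eq_image card_image)
  then show ?thesis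
    by (simp add: finite_multisets_of_size card_cartesian_product power2_eq_square)
qed

text \<open>The library identity takes the product over the letters that occur in \<open>A\<close>.
  A fixed \<open>X\<close> gives all multisets over the alphabet the same index set.\<close>

lemma real_card_permutations_of_multiset:
  assumes "finite X" "set_mset A \<subseteq> X"
  shows "real (card (permutations_of_multiset A)) =
    fact (size A) / (\<Prod>x\<in>X. fact (count A x))"
proof -
  \<comment> \<open>Letters of \<open>X\<close> missing from \<open>A\<close> contribute the factor
    \<open>fact 0 = 1\<close>.\<close>
  have "(\<Prod>x\<in>set_mset A. fact (count A x)) = (\<Prod>x\<in>X. fact (count A x) :: nat)"
    using assms by (intro prod.mono_neutral_left) (auto simp: not_in_iff)
  then have "card (permutations_of_multiset A) * (\<Prod>x\<in>X. fact (count A x)) = fact (size A)"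
    using card_permutations_of_multiset_aux[of A] by simp
  then have "real (card (permutations_of_multiset A) * (\<Prod>x\<in>X. fact (count A x))) =
      real (fact (size A))"
    by (rule arg_cong)
  then show ?thesis
    using assms(1) by (simp add: nonzero_eq_divide_eq)
qed

text \<open>At a letter of \<open>X\<close> only its own summand counts, and outside
  \<open>X\<close> both counts vanish. This lets a multiset be rebuilt from its
  multiplicities.\<close>

lemma multiset_eq_sum_replicate:
  assumes "finite X" "set_mset A \<subseteq> X"
  shows "(\<Sum>x\<in>X. replicate_mset (count A x) x) = A"
proof (rule multiset_eqI)
  fix y
  show "count (\<Sum>x\<in>X. replicate_mset (count A x) x) y = count A y"
    using assms by (auto simp: count_sum not_in_iff[symmetric])
qed

text \<open>A multiset over the alphabet amounts to its vector of multiplicities. Letters start at 1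
  and list positions at 0, hence the shift by \<open>Suc\<close>; the inverse \<open>?g\<close>
  collects \<open>ns ! i\<close> copies of the letter \<open>Suc i\<close>.\<close>

lemma bij_betw_counts_tuples_with_sum:
  "bij_betw (\<lambda>A. map (\<lambda>i. count A (Suc i)) [0..<k]) (multisets_of_size {1..k} n)
    (tuples_with_sum k n)"
proof (rule bij_betw_byWitness)
  let ?f = "\<lambda>A. map (\<lambda>i. count A (Suc i)) [0..<k]"
  let ?g = "\<lambda>ns. \<Sum>i<k. replicate_mset (ns ! i) (Suc i)"
  have count_g: "count (?g ns) (Suc i) = (if i < k then ns ! i else 0)" for ns i
    by (simp add: count_sum)
  have Suc_image: "{1..k} = Suc ` {..<k}"
    by (simp add: lessThan_atLeast0 atLeastLessThanSuc_atLeastAtMost)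
  have g_f: "?g (?f A) = A" if "set_mset A \<subseteq> {1..k}" for A
  proof -
    have "?g (?f A) = (\<Sum>x\<in>{1..k}. replicate_mset (count A x) x)"
      unfolding Suc_image by (simp add: sum.reindex)
    then show ?thesis
      using multiset_eq_sum_replicate[OF _ that] by simp
  qed
  have size_g: "size (?g ns) = sum_list ns" if "length ns = k" for ns
    using that by (simp add: sum_list_sum_nth lessThan_atLeast0)
  show "\<forall>A \<in> multisets_of_size {1..k} n. ?g (?f A) = A"
    using g_f by (auto simp: multisets_of_size_def)
  show "\<forall>ns \<in> tuples_with_sum k n. ?f (?g ns) = ns"
    by (auto simp: tuples_with_sum_def count_g intro!: nth_equalityI)
  show "?f ` multisets_of_size {1..k} n \<subseteq> tuples_with_sum k n"
  proof (rule image_subsetI)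
    fix A assume A: "A \<in> multisets_of_size {1..k} n"
    \<comment> \<open>The sum of the multiplicities is read off as the size of the multiset rebuilt
      from them, which is \<open>A\<close> itself.\<close>
    have "sum_list (?f A) = size (?g (?f A))"
      by (rule size_g[symmetric]) simp
    also have "\<dots> = n"
      using A g_f[of A] by (simp add: multisets_of_size_def del: One_nat_def)
    finally show "?f A \<in> tuples_with_sum k n"
      by (simp add: tuples_with_sum_def)
  qed
  show "?g ` tuples_with_sum k n \<subseteq> multisets_of_size {1..k} n"
  proof (rule image_subsetI)
    fix ns assume "ns \<in> tuples_with_sum k n"
    then have "size (?g ns) = n"
      using size_g[of ns] by (simp only: tuples_with_sum_def mem_Collect_eq)
    moreover have "set_mset (?g ns) \<subseteq> {1..k}"
      by (auto simp: set_mset_sum split: if_splits)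
    ultimately show "?g ns \<in> multisets_of_size {1..k} n"
      by (simp only: multisets_of_size_def mem_Collect_eq)
  qed
qed

theorem mainTheorem2:
  fixes k n :: nat
  assumes "k \<ge> 1"
  shows "real (num_abelian_squares k n) =
    (\<Sum>ns \<in> tuples_with_sum k n. (fact n / (\<Prod>i<k. fact (ns ! i)))\<^sup>2)"
proof -
  \<comment> \<open>The denominator is phrased through the list of multiplicities, so that the
    summand is a function of that list and the sum can be reindexed along the bijection.\<close>
  have "real (card (permutations_of_multiset A)) =
      fact n / (\<Prod>i<k. fact (map (\<lambda>i. count A (Suc i)) [0..<k] ! i))"
    if "A \<in> multisets_of_size {1..k} n" for A
  proof -
    \<comment> \<open>Passes from the letters 1 to k to the list positions 0 to k - 1.\<close>
    have "(\<Prod>x\<in>{1..k}. fact (count A x)) = (\<Prod>i<k. fact (count A (Suc i)) :: real)"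
      using prod.atLeast1_atMost_eq by simp
    with that show ?thesis
      by (simp add: multisets_of_size_def real_card_permutations_of_multiset[of "{1..k}"])
  qed
  then have "real (num_abelian_squares k n) = (\<Sum>A \<in> multisets_of_size {1..k} n.
      (fact n / (\<Prod>i<k. fact (map (\<lambda>i. count A (Suc i)) [0..<k] ! i)))\<^sup>2)"
    by (simp add: num_abelian_squares_eq_sum_multisets)
  also have "\<dots> = (\<Sum>ns \<in> tuples_with_sum k n. (fact n / (\<Prod>i<k. fact (ns ! i)))\<^sup>2)"
    using bij_betw_counts_tuples_with_sum by (rule sum.reindex_bij_betw)
  finally show ?thesis .
qed

end
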